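(* Let $k \ge 2$ and $\delta \ge 1$ be integers. If $F_1, F_2, \ldots, F_k$ are graphs on a common set of $n$ vertices, each of which has minimum degree at least $\delta$, then \[ \gamma_{\rm sd}(F_1,F_2,\ldots,F_k) \le \left( 1 - \left( \frac{\delta}{\delta + 1} \right) \left( \frac{1}{k(\delta + 1)} \right)^{\frac{1}{\delta}} \right) n. \]
   Context: All graphs are finite and simple. Given graphs $F_1,\ldots,F_k$ (called factors; not necessarily edge-disjoint) with common vertex set $V$, a set $S \subseteq V$ is a simultaneous dominating set if for every $i$, $1 \le i \le k$, every vertex not in $S$ is adjacent in $F_i$ to some vertex of $S$. The simultaneous domination number $\gamma_{\rm sd}(F_1,\ldots,F_k)$ is the minimum cardinality of a simultaneous dominating set. *)

theory Defs
  imports Complex_Main "Graph_Theory.Pair_Digraph"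
begin

text \<open>
  Finite simple graphs are represented by the locale \<^locale>\<open>pair_graph\<close>: finite, loop-free,
  symmetric digraphs without parallel arcs. Each edge \<open>uv\<close> gives the two arcs \<open>(u, v)\<close> and \<open>(v, u)\<close>,
  so the degree of a vertex is its out-degree.
  The null graph is allowed; its \<open>min_degree\<close> is the unspecified value of \<^const>\<open>Min\<close> on the
  empty set.
\<close>

definition min_degree :: "'a pair_pre_digraph \<Rightarrow> nat" where
  "min_degree G = Min (out_degree (with_proj G) ` pverts G)"

text \<open>
  The factors are given as a list, so that the same graph may occur repeatedly among them.
\<close>

definition sim_dominating :: "'a set \<Rightarrow> 'a pair_pre_digraph list \<Rightarrow> 'a set \<Rightarrow> bool" where
  "sim_dominating V Fs S \<longleftrightarrow>
     S \<subseteq> V \<and> (\<forall>F\<in>set Fs. \<forall>v\<in>V - S. \<exists>u\<in>S. v \<rightarrow>\<^bsub>with_proj F\<^esub> u)"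

definition gamma_sd :: "'a set \<Rightarrow> 'a pair_pre_digraph list \<Rightarrow> nat" where
  "gamma_sd V Fs = Min (card ` {S. sim_dominating V Fs S})"

lemma min_degree_ge_iff:
  assumes "pair_graph G" "pverts G \<noteq> {}"
  shows "d \<le> min_degree G \<longleftrightarrow> (\<forall>v\<in>pverts G. d \<le> card {u. (v, u) \<in> parcs G})"
proof -
  interpret pair_graph G by fact
  have "out_arcs (with_proj G) v = Pair v ` {u. (v, u) \<in> parcs G}" for v
    by (auto simp: out_arcs_def)
  then have "out_degree (with_proj G) v = card {u. (v, u) \<in> parcs G}" for v
    by (simp add: out_degree_def card_image inj_on_def)
  then show ?thesis
    using assms(2) pair_finite_verts by (simp add: min_degree_def)
qed

lemma gamma_sd_le:
  assumes "finite V" "sim_dominating V Fs S"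
  shows "gamma_sd V Fs \<le> card S"
proof -
  have "finite {S. sim_dominating V Fs S}"
    by (rule finite_subset[of _ "Pow V"]) (use assms(1) in \<open>auto simp: sim_dominating_def\<close>)
  then show ?thesis
    using assms(2) by (auto simp: gamma_sd_def)
qed

lemma gamma_sd_attained:
  assumes "finite V"
  obtains S where "sim_dominating V Fs S" "card S = gamma_sd V Fs"
proof -
  have fin: "finite {S. sim_dominating V Fs S}"
    by (rule finite_subset[of _ "Pow V"]) (use assms in \<open>auto simp: sim_dominating_def\<close>)
  have "sim_dominating V Fs V"
    by (simp add: sim_dominating_def)
  then have "gamma_sd V Fs \<in> card ` {S. sim_dominating V Fs S}"
    unfolding gamma_sd_def using fin by (intro Min_in) auto
  with that show ?thesis by auto
qed

end

theory Submission
  imports Defs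
begin

text \<open>
  The probabilistic method: put every vertex into a random set \<open>S\<close> independently with probability
  \<open>1 - q\<close>, then add for each factor \<open>F\<close> the vertices whose closed \<open>F\<close>-neighbourhood misses \<open>S\<close>. A set
  with at least \<open>\<delta> + 1\<close> elements is missed with probability at most \<open>q\<^sup>\<delta>\<^sup>+\<^sup>1\<close>, so the expected size is
  at most \<open>(1 - q + k q\<^sup>\<delta>\<^sup>+\<^sup>1) n\<close>, which is minimal when \<open>k (\<delta> + 1) q\<^sup>\<delta> = 1\<close>.
\<close>

text \<open>For \<open>S \<subseteq> V\<close>, the probability that the random set equals
  \<open>S\<close>. Expectations become weighted sums over \<open>Pow V\<close>.\<close>

definition bernoulli_weight :: "'a set \<Rightarrow> real \<Rightarrow> 'a set \<Rightarrow> real" where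
  "bernoulli_weight V q S = (1 - q) ^ card S * q ^ card (V - S)"

lemma bernoulli_weight_nonneg: "0 \<le> q \<Longrightarrow> q \<le> 1 \<Longrightarrow> 0 \<le> bernoulli_weight V q S"
  by (simp add: bernoulli_weight_def)

text \<open>Expand a product over \<open>V\<close> of binomials, one choice (in \<open>S\<close> or
  not) per vertex. Giving membership weight 0 on \<open>N\<close> kills exactly the sets that meet
  \<open>N\<close>; each vertex then contributes \<open>0 + q\<close> inside \<open>N\<close> and
  \<open>(1 - q) + q = 1\<close> outside.\<close>

lemma sum_bernoulli_weight_disjoint:
  assumes "finite V" "N \<subseteq> V"
  shows "(\<Sum>S\<in>{S\<in>Pow V. S \<inter> N = {}}. bernoulli_weight V q S) = q ^ card N"
proof -
  let ?f = "\<lambda>v. if v \<in> N then 0 else 1 - q"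
  have f: "prod ?f S = (if S \<inter> N = {} then (1 - q) ^ card S else 0)" if "S \<subseteq> V" for S
  proof (cases "S \<inter> N = {}")
    case True
    then have "prod ?f S = (\<Prod>v\<in>S. 1 - q)"
      by (intro prod.cong) auto
    with True show ?thesis by simp
  next
    case False
    then show ?thesis
      using that assms(1) by (auto intro!: prod_zero dest: finite_subset)
  qed
  have "(\<Sum>S\<in>{S\<in>Pow V. S \<inter> N = {}}. bernoulli_weight V q S)
      = (\<Sum>S\<in>Pow V. if S \<inter> N = {} then bernoulli_weight V q S else 0)"
    using assms(1) by (simp only: sum.inter_filter finite_Pow_iff)
  also have "\<dots> = (\<Sum>S\<in>Pow V. prod ?f S * (\<Prod>v\<in>V - S. q))"
    by (rule sum.cong) (auto simp: f bernoulli_weight_def)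
  also have "\<dots> = (\<Prod>v\<in>V. ?f v + q)"
    using assms(1) by (simp add: prod_add)
  also have "\<dots> = (\<Prod>v\<in>V. if v \<in> N then q else 1)"
    by (rule prod.cong) auto
  also have "\<dots> = q ^ card N"
    using assms by (simp add: prod.If_cases Int_absorb1)
  finally show ?thesis .
qed

lemma sum_bernoulli_weight:
  assumes "finite V"
  shows "(\<Sum>S\<in>Pow V. bernoulli_weight V q S) = 1"
  using sum_bernoulli_weight_disjoint[OF assms, of "{}" q] by (simp add: Pow_def)

text \<open>Linearity of expectation: the count is a sum of indicators, and the two sums are
  swapped.\<close>

lemma sum_bernoulli_weight_card_missed:
  assumes "finite V" "\<And>v. v \<in> V \<Longrightarrow> N v \<subseteq> V"
  shows "(\<Sum>S\<in>Pow V. bernoulli_weight V q S * card {v\<in>V. S \<inter> N v = {}}) = (\<Sum>v\<in>V. q ^ card (N v))"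
proof -
  have "(\<Sum>S\<in>Pow V. bernoulli_weight V q S * card {v\<in>V. S \<inter> N v = {}})
      = (\<Sum>S\<in>Pow V. \<Sum>v\<in>V. if S \<inter> N v = {} then bernoulli_weight V q S else 0)"
    using assms(1) by (intro sum.cong refl) (simp add: mult.commute flip: sum.inter_filter)
  also have "\<dots> = (\<Sum>v\<in>V. \<Sum>S\<in>Pow V. if S \<inter> N v = {} then bernoulli_weight V q S else 0)"
    by (rule sum.swap)
  also have "\<dots> = (\<Sum>v\<in>V. \<Sum>S\<in>{S\<in>Pow V. S \<inter> N v = {}}. bernoulli_weight V q S)"
    using assms(1) by (simp only: sum.inter_filter finite_Pow_iff)
  also have "\<dots> = (\<Sum>v\<in>V. q ^ card (N v))"
    using assms by (intro sum.cong refl sum_bernoulli_weight_disjoint) auto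
  finally show ?thesis .
qed

definition closed_nbhd :: "'a pair_pre_digraph \<Rightarrow> 'a \<Rightarrow> 'a set" where
  "closed_nbhd F v = insert v {u. (v, u) \<in> parcs F}"

lemma closed_nbhd_subset:
  assumes "pair_graph F" "v \<in> pverts F"
  shows "closed_nbhd F v \<subseteq> pverts F"
proof -
  interpret pair_graph F by fact
  show ?thesis
    using assms(2) by (auto simp: closed_nbhd_def dest: in_arcsD2)
qed

text \<open>Without loops, \<open>v\<close> comes on top of its neighbours. The vertex
  \<open>v\<close> also shows that the graph is not null, so \<open>min_degree\<close> is a genuine
  minimum.\<close>

lemma card_closed_nbhd:
  assumes "pair_graph F" "v \<in> pverts F" "\<delta> \<le> min_degree F"
  shows "Suc \<delta> \<le> card (closed_nbhd F v)"
proof -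
  interpret pair_graph F by fact
  have "finite (closed_nbhd F v)"
    using closed_nbhd_subset[OF assms(1,2)] by (rule finite_subset) simp
  moreover have "(v, v) \<notin> parcs F"
    using no_loops by fastforce
  moreover have "\<delta> \<le> card {u. (v, u) \<in> parcs F}"
    using assms by (subst (asm) min_degree_ge_iff) auto
  ultimately show ?thesis
    by (simp add: closed_nbhd_def)
qed

text \<open>Adding all missed vertices repairs \<open>S\<close>: for any other vertex outside
  \<open>S\<close>, each closed neighbourhood meets \<open>S\<close>, necessarily in a proper
  neighbour.\<close>

lemma gamma_sd_le_card_add_missed:
  assumes "finite V" "S \<subseteq> V"
  shows "gamma_sd V Fs \<le> card S + (\<Sum>F\<in>set Fs. card {v\<in>V. S \<inter> closed_nbhd F v = {}})"
proof -
  let ?T = "\<Union>F\<in>set Fs. {v\<in>V. S \<inter> closed_nbhd F v = {}}"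
  have "sim_dominating V Fs (S \<union> ?T)"
    using assms(2) by (auto simp: sim_dominating_def closed_nbhd_def arcs_ends_def arc_to_ends_def)
  then have "gamma_sd V Fs \<le> card (S \<union> ?T)"
    by (rule gamma_sd_le[OF assms(1)])
  also have "\<dots> \<le> card S + card ?T"
    by (rule card_Un_le)
  also have "card ?T \<le> (\<Sum>F\<in>set Fs. card {v\<in>V. S \<inter> closed_nbhd F v = {}})"
    by (rule card_UN_le) simp
  finally show ?thesis by simp
qed

lemma gamma_sd_le_expectation:
  assumes "finite V" "0 \<le> q" "q \<le> 1"
    and Fs: "\<And>F. F \<in> set Fs \<Longrightarrow> pair_graph F \<and> pverts F = V \<and> min_degree F \<ge> \<delta>"
  shows "real (gamma_sd V Fs) \<le> (1 - q + real (length Fs) * q ^ Suc \<delta>) * real (card V)"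
proof -
  let ?w = "bernoulli_weight V q"
  let ?missed = "\<lambda>N S. card {v\<in>V. S \<inter> N v = {}}"
  \<comment> \<open>A vertex lies outside \<open>S\<close> iff \<open>S\<close> misses its
    singleton, so the expected size of \<open>S\<close> comes from the same counting lemma, with
    \<open>N v = {v}\<close>.\<close>
  have card: "real (card S) = real (card V) - real (?missed (\<lambda>v. {v}) S)" if "S \<subseteq> V" for S
  proof -
    have "{v\<in>V. S \<inter> {v} = {}} = V - S" by auto
    then show ?thesis
      using that assms(1) by (simp add: card_Diff_subset card_mono finite_subset)
  qed
  have missed: "(\<Sum>S\<in>Pow V. ?w S * ?missed (closed_nbhd F) S) \<le> real (card V) * q ^ Suc \<delta>"
    if "F \<in> set Fs" for F
  proof -
    have F: "pair_graph F" "pverts F = V" "\<delta> \<le> min_degree F"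
      using Fs[OF that] by auto
    have "(\<Sum>S\<in>Pow V. ?w S * ?missed (closed_nbhd F) S) = (\<Sum>v\<in>V. q ^ card (closed_nbhd F v))"
      using closed_nbhd_subset[OF F(1)] F(2) by (intro sum_bernoulli_weight_card_missed assms(1)) auto
    also have "\<dots> \<le> (\<Sum>v\<in>V. q ^ Suc \<delta>)"
      using card_closed_nbhd[OF F(1) _ F(3)] F(2) assms(2,3) by (intro sum_mono power_decreasing) auto
    finally show ?thesis by simp
  qed
  \<comment> \<open>The weights sum to 1, so a constant is its own average; the bound valid for
    every \<open>S\<close> can then be averaged.\<close>
  have "real (gamma_sd V Fs) = (\<Sum>S\<in>Pow V. ?w S * real (gamma_sd V Fs))"
    using assms(1) by (simp add: sum_bernoulli_weight flip: sum_distrib_right)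
  also have "\<dots> \<le> (\<Sum>S\<in>Pow V. ?w S * real (card S + (\<Sum>F\<in>set Fs. ?missed (closed_nbhd F) S)))"
    using assms(1-3)
    by (intro sum_mono mult_left_mono of_nat_mono gamma_sd_le_card_add_missed bernoulli_weight_nonneg) auto
  also have "\<dots> = (\<Sum>S\<in>Pow V. ?w S * real (card V) - ?w S * ?missed (\<lambda>v. {v}) S
      + (\<Sum>F\<in>set Fs. ?w S * ?missed (closed_nbhd F) S))"
  proof (intro sum.cong refl)
    fix S assume "S \<in> Pow V"
    then show "?w S * real (card S + (\<Sum>F\<in>set Fs. ?missed (closed_nbhd F) S))
        = ?w S * real (card V) - ?w S * ?missed (\<lambda>v. {v}) S
          + (\<Sum>F\<in>set Fs. ?w S * ?missed (closed_nbhd F) S)"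
      by (simp only: Pow_iff card[of S] of_nat_add of_nat_sum sum_distrib_left ring_distribs)
  qed
  also have "\<dots> = real (card V) - real (card V) * q
      + (\<Sum>S\<in>Pow V. \<Sum>F\<in>set Fs. ?w S * ?missed (closed_nbhd F) S)"
    using assms(1) sum_bernoulli_weight_card_missed[OF assms(1), of "\<lambda>v. {v}" q]
    by (simp add: sum.distrib sum_subtractf sum_bernoulli_weight flip: sum_distrib_right)
  also have "(\<Sum>S\<in>Pow V. \<Sum>F\<in>set Fs. ?w S * ?missed (closed_nbhd F) S)
      = (\<Sum>F\<in>set Fs. \<Sum>S\<in>Pow V. ?w S * ?missed (closed_nbhd F) S)"
    by (rule sum.swap)
  also have "real (card V) - real (card V) * q
      + (\<Sum>F\<in>set Fs. \<Sum>S\<in>Pow V. ?w S * ?missed (closed_nbhd F) S)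
      \<le> real (card V) - real (card V) * q + real (card (set Fs)) * (real (card V) * q ^ Suc \<delta>)"
    using sum_mono[OF missed] by simp
  \<comment> \<open>The union was taken over distinct factors; repetitions in \<open>Fs\<close> can
    only make its length larger.\<close>
  also have "\<dots> \<le> real (card V) - real (card V) * q
      + real (length Fs) * (real (card V) * q ^ Suc \<delta>)"
    using assms(2) by (intro add_left_mono mult_right_mono) (simp_all add: card_length)
  finally show ?thesis by (simp add: algebra_simps)
qed

theorem theorem12:
  fixes k \<delta> n :: nat and V :: "'a set" and Fs :: "'a pair_pre_digraph list"
  assumes "k \<ge> 2" and "\<delta> \<ge> 1"
    and "finite V" and "card V = n"
    and "length Fs = k"
    and "\<And>F. F \<in> set Fs \<Longrightarrow> pair_graph F \<and> pverts F = V \<and> min_degree F \<ge> \<delta>"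
  shows "real (gamma_sd V Fs) \<le>
    (1 - (real \<delta> / (real \<delta> + 1)) * (1 / (real k * (real \<delta> + 1))) powr (1 / real \<delta>)) * real n"
proof -
  define c where "c = 1 / (real k * (real \<delta> + 1))"
  define q where "q = c powr (1 / real \<delta>)"
  \<comment> \<open>This gives \<open>c \<le> 1\<close>, hence \<open>q \<le> 1\<close>, so that
    \<open>q\<close> is a probability.\<close>
  have "1 * 1 \<le> real k * (real \<delta> + 1)"
    using assms(1) by (intro mult_mono) auto
  then have c: "0 < c" "c \<le> 1"
    by (auto simp: c_def)
  then have q: "0 \<le> q" "q \<le> 1"
    by (auto simp: q_def powr_le1)
  have "q ^ \<delta> = c"
    using c(1) assms(2) by (simp add: q_def powr_powr flip: powr_realpow)
  \<comment> \<open>\<open>q ^ Suc \<delta>\<close> is \<open>q * c\<close>, and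
    \<open>k * c\<close> is \<open>1 / (\<delta> + 1)\<close>.\<close>
  then have "real k * q ^ Suc \<delta> = q / (real \<delta> + 1)"
    using assms(1) by (simp add: c_def)
  then have bound: "1 - q + real k * q ^ Suc \<delta> = 1 - real \<delta> / (real \<delta> + 1) * q"
    by (simp add: field_simps)
  have "real (gamma_sd V Fs) \<le> (1 - q + real k * q ^ Suc \<delta>) * real n"
    using gamma_sd_le_expectation[OF assms(3) q assms(6), of Fs] assms(4,5) by simp
  then show ?thesis
    unfolding bound by (simp only: q_def c_def)
qed

end
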